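(* Let $m\in\mathbb{N}$ (with $0$ allowed), and let $H(x)=\sum_{n\geq 0}h(n)x^n$ and $B(x)=\sum_{n\geq 0}b(n)x^n$ be generating functions such that $B(x)=H\big(xB(x)^m\big)$. Let $H_x^{\Delta}(n,k)$ and $B_x^{\Delta}(n,k)$ be the compositae of the generating functions $xH(x)$ and $xB(x)$, respectively. Then for all integers $n\geq k\geq 1$ $$B_x^{\Delta}(n,k)=\frac{k}{i_{m-1}}\,H_x^{\Delta}(i_m,i_{m-1}),$$ where $i_m=(m+1)n-mk$ (so $i_{m-1}=mn-(m-1)k$).
   Context: Generating functions are formal power series over a field of characteristic zero (e.g. $\mathbb{C}$). For a generating function $F(x)=\sum_{n>0}f(n)x^n$ with zero constant term, its composita is the function of two variables $F^{\Delta}(n,k)=\sum f(\lambda_1)f(\lambda_2)\cdots f(\lambda_k)$, the sum being over all compositions $(\lambda_1,\dots,\lambda_k)$ of $n$ into $k$ parts (positive integers $\lambda_i$ with $\lambda_1+\cdots+\lambda_k=n$); equivalently $F^{\Delta}(n,k)=[x^n]F(x)^k$ for $k\geq 1$. Convention: $B(x)^0=1$. *)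

theory Defs
  imports "HOL-Computational_Algebra.Formal_Power_Series"
begin

definition compositions :: "nat \<Rightarrow> nat \<Rightarrow> nat list set" where
  "compositions n k = {l. length l = k \<and> (\<forall>p\<in>set l. 0 < p) \<and> sum_list l = n}"

lemma finite_compositions: "finite (compositions n k)"
proof (rule finite_subset)
  show "compositions n k \<subseteq> {l. set l \<subseteq> {..n} \<and> length l = k}"
    by (auto simp: compositions_def dest: member_le_sum_list)
  show "finite {l. set l \<subseteq> {..n} \<and> length l = k}"
    by (rule finite_lists_length_eq) simp
qed

text \<open>Only used for series with zero constant term; the constant term is never read.\<close>

definition composita :: "'a::comm_semiring_1 fps \<Rightarrow> nat \<Rightarrow> nat \<Rightarrow> 'a" where
  "composita F n k = (\<Sum>l\<in>compositions n k. prod_list (map (fps_nth F) l))"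

text \<open>The index \<open>i_m = (m + 1) n - m k\<close>. It is integer-valued in an integer index \<open>m\<close> because
  \<open>i_{m-1}\<close> is needed also for \<open>m = 0\<close>, where it equals \<open>k\<close>. For \<open>n \<ge> k \<ge> 1\<close> and \<open>m \<ge> -1\<close> it is
  positive, so converting it to \<open>nat\<close> loses nothing.\<close>

definition idx :: "nat \<Rightarrow> nat \<Rightarrow> int \<Rightarrow> int" where
  "idx n k m = (m + 1) * int n - m * int k"

end

theory Submission
  imports Defs
begin

text \<open>
  Extracting coefficients turns the compositae of \<open>x B(x)\<close> and \<open>x H(x)\<close> into coefficients of
  powers. With \<open>d = n - k\<close> the claim becomes
  \<open>[x\<^sup>d] B\<^sup>k = k / (k + m d) \<cdot> [x\<^sup>d] H\<^bsup>k + m d\<^esup>\<close>, an instance of Lagrange inversion: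
  the series \<open>w = x B\<^sup>m\<close> solves \<open>w = x \<phi>(w)\<close> for \<open>\<phi> = H\<^sup>m\<close>, and \<open>B\<^sup>k = H\<^sup>k(w)\<close>.
  Lagrange's formula for the outer series \<open>H\<^sup>k\<close> involves
  \<open>x (H\<^sup>k)' H\<^bsup>m d\<^esup>\<close>, which is \<open>k / (k + m d)\<close> times \<open>x (H\<^bsup>k + m d\<^esup>)'\<close>, and that
  is why the answer is again a coefficient of a power of \<open>H\<close>.

  The usual argument for Lagrange inversion through residues of Laurent series needs
  \<open>\<phi>(0) \<noteq> 0\<close>, that is \<open>H(0) \<noteq> 0\<close>. Here it is obtained by induction on the order of
  the coefficient instead (\<open>Lagrange_inversion\<close>): in \<open>w\<^sup>j = x\<^sup>j \<phi>\<^sup>j(w)\<close> the factor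
  \<open>x\<^sup>j\<close> lowers the order, and no series has to be inverted.
\<close>

unbundle fps_syntax

section \<open>Compositae as coefficients of powers\<close>

text \<open>The coefficient of a power is a sum over tuples of exponents that may vanish; the
  tuples with a vanishing exponent contribute the factor \<open>F(0) = 0\<close>.\<close>

lemma composita_eq_nth_power:
  fixes F :: "'a::comm_ring_1 fps"
  assumes "F $ 0 = 0" "k > 0"
  shows "composita F n k = (F ^ k) $ n"
proof -
  have prod: "prod_list (map (fps_nth F) l) = (\<Prod>j = 0..k - 1. F $ (l ! j))"
    if "length l = k" for l
  proof -
    have "{0..<k} = {0..k - 1}" using \<open>k > 0\<close> by auto
    then show ?thesis
      using that \<open>k > 0\<close> by (auto simp: prod.list_conv_set_nth intro!: prod.cong)
  qed
  have "composita F n k = (\<Sum>l\<in>natpermute n k. prod_list (map (fps_nth F) l))"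
    unfolding composita_def
  proof (rule sum.mono_neutral_left)
    show "\<forall>l\<in>natpermute n k - compositions n k. prod_list (map (fps_nth F) l) = 0"
    proof
      fix l assume "l \<in> natpermute n k - compositions n k"
      then have "0 \<in> set l" by (auto simp: natpermute_def compositions_def)
      then have "F $ 0 \<in> set (map (fps_nth F) l)" by (metis image_eqI set_map)
      then show "prod_list (map (fps_nth F) l) = 0"
        using assms(1) by (induction l) auto
    qed
  qed (auto simp: natpermute_finite, auto simp: natpermute_def compositions_def)
  also have "\<dots> = (F ^ k) $ n"
    unfolding fps_power_nth using \<open>k > 0\<close>
    by (simp add: natpermute_def prod)
  finally show ?thesis .
qed

lemma composita_fps_X_mult:
  fixes F :: "'a::comm_ring_1 fps"
  assumes "1 \<le> k"
  shows "composita (fps_X * F) (k + d) k = (F ^ k) $ d"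
  using assms
  by (simp add: composita_eq_nth_power power_mult_distrib fps_X_power_mult_nth)

section \<open>Lagrange inversion without inverses\<close>

lemma nth_fps_X_mult_deriv:
  "(fps_X * fps_deriv F) $ n = of_nat n * (F $ n :: 'a::comm_ring_1)"
  by (cases n) simp_all

text \<open>Both sides equal \<open>a (a + b) F' F\<^bsup>a + b - 1\<^esup>\<close>. The identity lets a product of
  powers be read as one derivative, both in the induction step of Lagrange inversion and in its
  application to powers of \<open>H\<close>.\<close>

lemma mult_deriv_power_power:
  fixes F :: "'a::comm_ring_1 fps"
  shows "of_nat (a + b) * (fps_deriv (F ^ a) * F ^ b) = of_nat a * fps_deriv (F ^ (a + b))"
  by (cases a) (simp_all add: fps_deriv_power' power_add mult_ac del: power_Suc of_nat_Suc of_nat_add)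

text \<open>The Euler operator \<open>F \<mapsto> x F'\<close> is used in place of the derivative so that the formula
  also covers \<open>n = 0\<close> and avoids the shift to the coefficient \<open>n - 1\<close>.\<close>

theorem Lagrange_inversion:
  fixes G \<phi> w :: "'a::{idom, ring_char_0} fps"
  assumes w: "w = fps_X * (\<phi> oo w)"
  shows "of_nat n * (G oo w) $ n = (fps_X * fps_deriv G * \<phi> ^ n) $ n"
proof (induction n arbitrary: G rule: less_induct)
  case (less n)
  have w0: "w $ 0 = 0" by (subst w) simp
  have power_w: "w ^ j = fps_X ^ j * (\<phi> ^ j oo w)" for j
  proof -
    have "w ^ j = (fps_X * (\<phi> oo w)) ^ j" using w by simp
    then show ?thesis by (simp add: power_mult_distrib fps_compose_power[OF w0])
  qed
  \<comment> \<open>By linearity in \<open>G\<close> it suffices to treat the monomials \<open>x\<^sup>j\<close>.\<close>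
  have monomial: "of_nat n * (w ^ j) $ n = of_nat j * (\<phi> ^ n) $ (n - j)" if "j \<le> n" for j
  proof -
    consider "j = 0" | "j = n" | "0 < j" "j < n" using \<open>j \<le> n\<close> by linarith
    then show ?thesis
    proof cases
      case 3
      define d where "d = n - j"
      have n: "n = j + d" and "d < n" "d > 0" using 3 by (auto simp: d_def)
      have "of_nat d * (of_nat n * (\<phi> ^ j oo w) $ d)
          = of_nat n * (fps_X * fps_deriv (\<phi> ^ j) * \<phi> ^ d) $ d"
        using less.IH[OF \<open>d < n\<close>, of "\<phi> ^ j"] by (metis mult.left_commute)
      also have "\<dots> = (fps_X * (of_nat n * (fps_deriv (\<phi> ^ j) * \<phi> ^ d))) $ d"
        by (metis (no_types, lifting) fps_mult_left_const_nth fps_of_nat mult.assoc mult.left_commute)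
      also have "\<dots> = (fps_X * (of_nat j * fps_deriv (\<phi> ^ n))) $ d"
        using mult_deriv_power_power[of j d \<phi>] by (simp add: n)
      also have "\<dots> = of_nat j * (fps_X * fps_deriv (\<phi> ^ n)) $ d"
        by (metis (no_types, lifting) fps_mult_left_const_nth fps_of_nat mult.left_commute)
      also have "\<dots> = of_nat d * (of_nat j * (\<phi> ^ n) $ d)"
        by (simp only: nth_fps_X_mult_deriv mult.left_commute)
      finally have "of_nat n * (\<phi> ^ j oo w) $ d = of_nat j * (\<phi> ^ n) $ d"
        using \<open>d > 0\<close> by simp
      moreover have "(w ^ j) $ n = (\<phi> ^ j oo w) $ d"
        by (simp add: power_w fps_X_power_mult_nth n)
      ultimately show ?thesis by (simp add: d_def)
    qed (simp_all add: power_w fps_X_power_mult_nth)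
  qed
  have "of_nat n * (G oo w) $ n = (\<Sum>j = 0..n. G $ j * (of_nat n * (w ^ j) $ n))"
    by (simp add: fps_compose_nth sum_distrib_left algebra_simps)
  also have "\<dots> = (\<Sum>j = 0..n. (of_nat j * G $ j) * (\<phi> ^ n) $ (n - j))"
    by (intro sum.cong) (simp_all add: monomial)
  also have "\<dots> = (fps_X * fps_deriv G * \<phi> ^ n) $ n"
    by (simp only: fps_mult_nth[of "fps_X * fps_deriv G"] nth_fps_X_mult_deriv)
  finally show ?case .
qed

section \<open>Powers of the solution of \<open>B(x) = H(x B(x)\<^sup>m)\<close>\<close>

text \<open>Lagrange inversion for \<open>w = x B\<^sup>m\<close> and the outer series \<open>H\<^sup>k\<close>. Both sides of
  Lagrange's formula carry a factor \<open>d\<close>: on the left from the formula itself, on the right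
  because the Euler operator multiplies the \<open>d\<close>-th coefficient by \<open>d\<close>; cancelling it leaves
  the claim.\<close>

lemma nth_power_of_fixpoint:
  fixes H B :: "'a::{idom, ring_char_0} fps"
  assumes B: "B = H oo (fps_X * B ^ m)"
  shows "of_nat (k + m * d) * (B ^ k) $ d = of_nat k * (H ^ (k + m * d)) $ d"
proof (cases "d = 0")
  case True
  \<comment> \<open>Lagrange's formula is void here; the constant terms of \<open>B\<close> and \<open>H\<close> agree.\<close>
  have "B $ 0 = H $ 0" by (subst B) simp
  then show ?thesis by (simp add: True fps_power_zeroth)
next
  case False
  define w where "w = fps_X * B ^ m"
  have w0: "w $ 0 = 0" by (simp add: w_def)
  have power_B: "B ^ j = H ^ j oo w" for j
    by (metis B w_def w0 fps_compose_power)
  have w: "w = fps_X * (H ^ m oo w)"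
    by (subst power_B[symmetric]) (rule w_def)
  have "of_nat d * (of_nat (k + m * d) * (B ^ k) $ d)
      = of_nat (k + m * d) * (fps_X * fps_deriv (H ^ k) * (H ^ m) ^ d) $ d"
    using Lagrange_inversion[OF w, of d "H ^ k"] by (metis mult.left_commute power_B)
  also have "\<dots> = (fps_X * (of_nat (k + m * d) * (fps_deriv (H ^ k) * H ^ (m * d)))) $ d"
    by (metis (no_types, lifting) fps_mult_left_const_nth fps_of_nat mult.assoc mult.left_commute power_mult)
  also have "\<dots> = (fps_X * (of_nat k * fps_deriv (H ^ (k + m * d)))) $ d"
    by (simp only: mult_deriv_power_power)
  also have "\<dots> = of_nat k * (fps_X * fps_deriv (H ^ (k + m * d))) $ d"
    by (metis (no_types, lifting) fps_mult_left_const_nth fps_of_nat mult.left_commute)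
  also have "\<dots> = of_nat d * (of_nat k * (H ^ (k + m * d)) $ d)"
    by (simp only: nth_fps_X_mult_deriv mult.left_commute)
  finally show ?thesis using False by simp
qed

theorem theorem28:
  fixes H B :: "'a::field_char_0 fps" and m :: nat
  assumes "B = fps_compose H (fps_X * B ^ m)"
  shows "\<forall>n k :: nat. 1 \<le> k \<and> k \<le> n \<longrightarrow>
    composita (fps_X * B) n k =
      of_nat k / of_int (idx n k (int m - 1)) *
        composita (fps_X * H) (nat (idx n k (int m))) (nat (idx n k (int m - 1)))"
proof (intro allI impI, elim conjE)
  fix n k :: nat
  assume "1 \<le> k" "k \<le> n"
  define d where "d = n - k"
  define e where "e = k + m * d"
  have n: "n = k + d" using \<open>k \<le> n\<close> by (simp add: d_def)
  have "e \<ge> 1" using \<open>1 \<le> k\<close> by (simp add: e_def)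
  have idx: "idx n k (int m) = int (e + d)" "idx n k (int m - 1) = int e"
    by (simp_all add: idx_def n e_def algebra_simps)
  have "of_nat e * (B ^ k) $ d = of_nat k * (H ^ e) $ d"
    unfolding e_def by (rule nth_power_of_fixpoint[OF assms])
  then have "(B ^ k) $ d = of_nat k / of_nat e * (H ^ e) $ d"
    using \<open>e \<ge> 1\<close> by (simp add: field_simps)
  then show "composita (fps_X * B) n k =
      of_nat k / of_int (idx n k (int m - 1)) *
        composita (fps_X * H) (nat (idx n k (int m))) (nat (idx n k (int m - 1)))"
    using composita_fps_X_mult[OF \<open>1 \<le> k\<close>, of B d] composita_fps_X_mult[OF \<open>e \<ge> 1\<close>, of H d]
    by (simp only: idx n[symmetric] nat_int of_int_of_nat_eq)
qed

end
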